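(* Let $1\le p<\infty$, let $n\in\mathbb N$, and let $X$ be a Banach space over $\mathbb R$ or $\mathbb C$. Then $\Pi_p^{Lip}(X,\overset{n}{\dots},X;X)=\mathcal L({}^nX;X)$, i.e. every bounded $n$-linear operator from $X\times\overset{n}{\cdots}\times X$ to $X$ is Lipschitz $p$-summing, if and only if $X$ is finite dimensional.
   Context: $\mathcal L({}^nX;X)$ is the space of bounded $n$-linear operators $X\times\overset{n}{\cdots}\times X\to X$. $\mathcal L(X_1,\dots,X_n)$ is the space of bounded scalar $n$-linear forms with the supremum norm over the product of unit balls, $B_E$ the closed unit ball of $E$. A bounded $n$-linear operator $T:X_1\times\cdots\times X_n\to Y$ between Banach spaces is Lipschitz $p$-summing, $T\in\Pi_p^{Lip}(X_1,\dots,X_n;Y)$, if there is $c>0$ such that for all $k\in\mathbb N$ and all $u_1,\dots,u_k,v_1,\dots,v_k\in X_1\times\cdots\times X_n$, $$\Big(\sum_{i=1}^k\|T(u_i)-T(v_i)\|^p\Big)^{1/p}\le c\cdot\sup_{\varphi\in B_{\mathcal L(X_1,\dots,X_n)}}\Big(\sum_{i=1}^k|\varphi(u_i)-\varphi(v_i)|^p\Big)^{1/p}.$$ *)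

theory Defs
  imports Complex_Main
begin

text \<open>
  A Banach space over \<open>'k\<close>, where \<open>'k\<close> is \<^typ>\<open>real\<close> or \<^typ>\<open>complex\<close>. The library has no class
  of complex normed spaces, so the multiplication by scalars is an explicit parameter. The class
  \<^class>\<open>banach\<close> contributes the norm, its completeness and the underlying real structure, with
  which the \<open>'k\<close>-structure has to agree.
\<close>

locale banach_space_over = vector_space scale
  for scale :: "'k::real_normed_field \<Rightarrow> 'a::banach \<Rightarrow> 'a" +
  assumes norm_scale: "norm (scale c x) = norm c * norm x"
    and scale_of_real: "scale (of_real r) x = r *\<^sub>R x"

lemma banach_space_over_scaleR: "banach_space_over ((*\<^sub>R) :: real \<Rightarrow> 'a::banach \<Rightarrow> 'a)"
  by unfold_locales (simp_all add: scaleR_add_right scaleR_add_left)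

text \<open>
  The space \<open>\<L>(\<^sup>nX;Y)\<close> of bounded \<open>n\<close>-linear operators. The product \<open>X \<times> \<dots> \<times> X\<close> (\<open>n\<close> factors) is
  the function space \<open>'n \<Rightarrow> 'a\<close> over a finite index type \<open>'n\<close> with \<open>n = CARD('n) \<ge> 1\<close> elements.
\<close>

definition bounded_multilinear ::
  "('k::real_normed_field \<Rightarrow> 'a::real_normed_vector \<Rightarrow> 'a) \<Rightarrow>
   ('k \<Rightarrow> 'b::real_normed_vector \<Rightarrow> 'b) \<Rightarrow> (('n::finite \<Rightarrow> 'a) \<Rightarrow> 'b) set" where
  "bounded_multilinear sX sY =
     {T. (\<forall>x i. Vector_Spaces.linear sX sY (\<lambda>y. T (x(i := y)))) \<and>
         (\<exists>K. \<forall>x. norm (T x) \<le> (\<Prod>i\<in>UNIV. norm (x i)) * K)}"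

definition multilinear_norm ::
  "(('n::finite \<Rightarrow> 'a::real_normed_vector) \<Rightarrow> 'b::real_normed_vector) \<Rightarrow> real" where
  "multilinear_norm T = (SUP x\<in>{x. \<forall>i. norm (x i) \<le> 1}. norm (T x))"

text \<open>The closed unit ball of the space of bounded scalar \<open>n\<close>-linear forms on \<open>X \<times> \<dots> \<times> X\<close>.\<close>

definition form_ball ::
  "('k::real_normed_field \<Rightarrow> 'a::real_normed_vector \<Rightarrow> 'a) \<Rightarrow> (('n::finite \<Rightarrow> 'a) \<Rightarrow> 'k) set" where
  "form_ball sX = {\<phi> \<in> bounded_multilinear sX (*). multilinear_norm \<phi> \<le> 1}"

text \<open>
  Lipschitz \<open>p\<close>-summing operators. The supremum is one of real numbers; it is taken over a nonempty
  set that is bounded above (see \<open>bdd_above_form_ball\<close> below), so it is the genuine supremum.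
\<close>

definition Lipschitz_summing ::
  "real \<Rightarrow> ('k::real_normed_field \<Rightarrow> 'a::real_normed_vector \<Rightarrow> 'a) \<Rightarrow>
   ('k \<Rightarrow> 'b::real_normed_vector \<Rightarrow> 'b) \<Rightarrow> (('n::finite \<Rightarrow> 'a) \<Rightarrow> 'b) set" where
  "Lipschitz_summing p sX sY =
     {T \<in> bounded_multilinear sX sY.
       \<exists>c>0. \<forall>(k::nat) (u :: nat \<Rightarrow> 'n \<Rightarrow> 'a) (v :: nat \<Rightarrow> 'n \<Rightarrow> 'a).
         (\<Sum>i=1..k. norm (T (u i) - T (v i)) powr p) powr (1 / p)
           \<le> c * (SUP \<phi>\<in>form_ball sX.
                    (\<Sum>i=1..k. norm (\<phi> (u i) - \<phi> (v i)) powr p) powr (1 / p))}"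

context banach_space_over
begin

lemma zero_in_form_ball: "(\<lambda>_. 0) \<in> (form_ball scale :: (('n::finite \<Rightarrow> 'a) \<Rightarrow> 'k) set)"
proof -
  have "Vector_Spaces.linear scale (*) (\<lambda>_. 0)"
    by unfold_locales (simp_all add: algebra_simps)
  moreover have "(\<lambda>_. 0) \<in> {x :: 'n \<Rightarrow> 'a. \<forall>i. norm (x i) \<le> 1}"
    by simp
  then have "{x :: 'n \<Rightarrow> 'a. \<forall>i. norm (x i) \<le> 1} \<noteq> {}"
    by (metis empty_iff)
  then have "multilinear_norm (\<lambda>_ :: 'n \<Rightarrow> 'a. 0 :: 'k) = 0"
    by (simp add: multilinear_norm_def)
  ultimately show ?thesis
    by (simp add: form_ball_def bounded_multilinear_def exI[of _ 0])
qed

lemma multilinear_scale: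
  fixes \<phi> :: "('n::finite \<Rightarrow> 'a) \<Rightarrow> 'k"
  assumes "\<And>x i. Vector_Spaces.linear scale (*) (\<lambda>y. \<phi> (x(i := y)))"
  shows "\<phi> (\<lambda>i. scale (r i) (x i)) = (\<Prod>i\<in>UNIV. r i) * \<phi> x"
proof -
  have "\<phi> (\<lambda>i. if i \<in> S then scale (r i) (x i) else x i) = (\<Prod>i\<in>S. r i) * \<phi> x" if "finite S" for S
    using that
  proof induction
    case (insert j S)
    let ?z = "\<lambda>i. if i \<in> S then scale (r i) (x i) else x i"
    have "(\<lambda>i. if i \<in> insert j S then scale (r i) (x i) else x i) = ?z(j := scale (r j) (x j))"
      by auto
    moreover have "?z(j := x j) = ?z"
      using insert.hyps by auto
    moreover have "\<phi> (?z(j := scale (r j) (x j))) = r j * \<phi> (?z(j := x j))"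
      using module_hom.scale[OF Vector_Spaces.linear.axioms(3)[OF assms[of ?z j]], of "r j" "x j"] by simp
    ultimately show ?case
      using insert by (simp add: mult.assoc)
  qed simp
  from this[of UNIV] show ?thesis by simp
qed

lemma form_ball_le:
  fixes \<phi> :: "('n::finite \<Rightarrow> 'a) \<Rightarrow> 'k"
  assumes "\<phi> \<in> form_ball scale"
  shows "norm (\<phi> x) \<le> (\<Prod>i\<in>UNIV. norm (x i))"
proof -
  have lin: "\<And>x i. Vector_Spaces.linear scale (*) (\<lambda>y. \<phi> (x(i := y)))"
    and le1: "(SUP x\<in>{x. \<forall>i. norm (x i) \<le> 1}. norm (\<phi> x)) \<le> 1"
    using assms by (auto simp: form_ball_def bounded_multilinear_def multilinear_norm_def)
  obtain K where K: "norm (\<phi> x) \<le> (\<Prod>i\<in>UNIV. norm (x i)) * K" for x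
    using assms by (auto simp: form_ball_def bounded_multilinear_def)
  have "norm (\<phi> y) \<le> \<bar>K\<bar>" if "\<forall>i. norm (y i) \<le> 1" for y
  proof -
    have "norm (\<phi> y) \<le> (\<Prod>i\<in>UNIV. norm (y i)) * \<bar>K\<bar>"
      by (rule order_trans[OF K]) (intro mult_left_mono prod_nonneg; simp)
    also have "\<dots> \<le> 1 * \<bar>K\<bar>"
      using that by (intro mult_right_mono prod_le_1) auto
    finally show ?thesis by simp
  qed
  then have bdd: "bdd_above ((\<lambda>x. norm (\<phi> x)) ` {x. \<forall>i. norm (x i) \<le> 1})"
    by (auto simp: bdd_above_def)
  have ball: "norm (\<phi> y) \<le> 1" if "\<forall>i. norm (y i) \<le> 1" for y
    by (rule order_trans[OF cSUP_upper[OF _ bdd] le1]) (simp add: that)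
  show ?thesis
  proof (cases "\<exists>i. x i = 0")
    case True
    then have "(\<Prod>i\<in>UNIV. norm (x i)) = 0" by auto
    then show ?thesis using K[of x] by (metis mult_zero_left)
  next
    case False
    define y where "y i = scale (of_real (inverse (norm (x i)))) (x i)" for i
    have "(\<lambda>i. scale (of_real (norm (x i))) (y i)) = x"
      using False by (auto simp: y_def scale_of_real)
    then have "\<phi> x = (\<Prod>i\<in>UNIV. of_real (norm (x i))) * \<phi> y"
      using multilinear_scale[OF lin, of "\<lambda>i. of_real (norm (x i))" y] by simp
    then have "norm (\<phi> x) = (\<Prod>i\<in>UNIV. norm (x i)) * norm (\<phi> y)"
      by (simp add: norm_mult flip: prod_norm)
    moreover have "norm (\<phi> y) \<le> 1"
      using False by (intro ball) (simp add: y_def norm_scale norm_inverse)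
    ultimately show ?thesis
      by (simp add: mult_left_le prod_nonneg)
  qed
qed

lemma bdd_above_form_ball:
  fixes u v :: "nat \<Rightarrow> 'n::finite \<Rightarrow> 'a"
  assumes "0 \<le> p"
  shows "bdd_above ((\<lambda>\<phi>. (\<Sum>i=1..k. norm (\<phi> (u i) - \<phi> (v i)) powr p) powr (1 / p)) ` form_ball scale)"
proof (rule bdd_aboveI2)
  fix \<phi> :: "('n \<Rightarrow> 'a) \<Rightarrow> 'k" assume "\<phi> \<in> form_ball scale"
  then have "norm (\<phi> (u i) - \<phi> (v i)) \<le> (\<Prod>j\<in>UNIV. norm (u i j)) + (\<Prod>j\<in>UNIV. norm (v i j))" for i
    by (intro order_trans[OF norm_triangle_ineq4] add_mono form_ball_le)
  then show "(\<Sum>i=1..k. norm (\<phi> (u i) - \<phi> (v i)) powr p) powr (1 / p)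
      \<le> (\<Sum>i=1..k. ((\<Prod>j\<in>UNIV. norm (u i j)) + (\<Prod>j\<in>UNIV. norm (v i j))) powr p) powr (1 / p)"
    using assms by (intro powr_mono2 sum_mono sum_nonneg) auto
qed

end

end

theory Submission
  imports Defs "HOL-Analysis.Convex" "HOL-Analysis.Bounded_Linear_Function"
    "HOL-Analysis.Bounded_Continuous_Function"
begin

text \<open>
  If \<open>X\<close> is finite dimensional, write the identity of \<open>X\<close> as \<open>y = \<Sum>\<^sub>j f\<^sub>j(y) b\<^sub>j\<close> with finitely many bounded
  functionals \<open>f\<^sub>j\<close> (\<open>finite_coordinates\<close>). For an \<open>n\<close>-linear operator \<open>T\<close> every \<open>f\<^sub>j \<circ> T\<close> is a multiple
  of a form in the unit ball, so each coordinate of \<open>T u - T v\<close> is controlled by the supremum in the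
  definition, and so is \<open>T\<close>.

  Conversely, fix a unit vector \<open>e\<close> and a bounded functional \<open>f\<close> with \<open>f e = 1\<close>, and apply the hypothesis to
  \<open>T(x\<^sub>1,\<dots>,x\<^sub>n) = f(x\<^sub>2)\<cdots>f(x\<^sub>n) x\<^sub>1\<close> at the points \<open>(x,e,\<dots>,e)\<close> and \<open>(0,e,\<dots>,e)\<close>. There \<open>T\<close> is the
  identity of \<open>X\<close>, and a form in the unit ball is a linear functional of norm at most one. So the identity
  of \<open>X\<close> is absolutely \<open>p\<close>-summing, and what remains is the theorem of Dvoretzky and Rogers that this
  forces \<open>dim X < \<infinity>\<close>. Its proof has three steps.

  The passage from \<open>p\<close> to \<open>2\<close> (\<open>identity_summing_imp_two_summing\<close>): rescale each \<open>y\<close> to \<open>\<parallel>y\<parallel>\<^bsup>2/p-1\<^esup> y\<close>. The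
  left-hand side becomes \<open>\<Sum>\<parallel>y\<parallel>\<^sup>2\<close>, and on the right \<open>p \<ge> 1\<close> gives the bound \<open>\<Sum>\<parallel>y\<parallel> \<bar>g(y)\<bar>\<close>, which
  the inequality of the arithmetic and geometric means splits into a part absorbed by the left-hand side
  and a multiple of \<open>\<Sum>\<bar>g(y)\<bar>\<^sup>2\<close>. This covers \<open>p < 2\<close> and \<open>p > 2\<close> alike.

  Pietsch domination (\<open>Pietsch_domination\<close>): the Mazur-Orlicz theorem gives a mean \<open>l\<close> on the bounded
  functions of functionals \<open>F\<close> in the dual ball with \<open>\<parallel>x\<parallel>\<^sup>2 \<le> C l(F \<mapsto> F(x)\<^sup>2)\<close>. Since \<open>l\<close> need only
  be finitely additive, neither a weak topology nor a representation theorem enters.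

  Counting dimensions (\<open>two_summing_identity_card_independent_le\<close>): \<open>\<beta>(x,y) = l(F \<mapsto> F(x) F(y))\<close> is an
  inner product. For \<open>\<beta>\<close>-orthonormal vectors \<open>e\<^sub>1,\<dots>,e\<^sub>d\<close> the inequality \<open>\<parallel>x\<parallel>\<^sup>2 \<le> C \<beta>(x,x)\<close> gives
  \<open>\<Sum>\<^sub>i F(e\<^sub>i)\<^sup>2 \<le> C\<close> for each \<open>F\<close>. The mean of the left-hand side is \<open>d\<close>, so \<open>d \<le> C\<close>.

  The last two steps take place over the reals. The first one also passes from complex to real functionals:
  real and imaginary part of a complex functional of norm at most one are real functionals of norm at most one.
\<close>

section \<open>Sublinear functionals and the theorem of Mazur and Orlicz\<close>

text \<open>
  Only one inequality is required in the homogeneity, because the other follows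
  (\<open>sublinear_scaleR\<close>) and infima of families then need one estimate only.
\<close>
definition sublinear :: "('v::real_vector \<Rightarrow> real) \<Rightarrow> bool" where
  "sublinear q \<longleftrightarrow> (\<forall>x y. q (x + y) \<le> q x + q y) \<and> (\<forall>c\<ge>0. \<forall>x. q (c *\<^sub>R x) \<le> c * q x)"

lemma sublinearD:
  assumes "sublinear q"
  shows "q (x + y) \<le> q x + q y" "0 \<le> c \<Longrightarrow> q (c *\<^sub>R x) \<le> c * q x"
    "q 0 = 0" "- q (- x) \<le> q x"
proof -
  have add: "q (x + y) \<le> q x + q y" and scale: "0 \<le> c \<Longrightarrow> q (c *\<^sub>R x) \<le> c * q x" for x y c
    using assms by (auto simp: sublinear_def)
  show "q (x + y) \<le> q x + q y" "0 \<le> c \<Longrightarrow> q (c *\<^sub>R x) \<le> c * q x" by fact+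
  show zero: "q 0 = 0" using add[of 0 0] scale[of 0 0] by simp
  show "- q (- x) \<le> q x" using add[of x "- x"] zero by simp
qed

text \<open>
  A linear \<open>l \<le> q\<close> with \<open>l h \<ge> a\<close> for all \<open>(h, a) \<in> I\<close> satisfies \<open>l y = l (y + h) - l h \<le> q (y + h) - a\<close>.
  The infimum of these bounds is again sublinear because \<open>I\<close> is a convex cone, and it is finite because
  \<open>q (y + h) \<ge> q h - q (- y) \<ge> a - q (- y)\<close>. Every linear functional below the infimum meets the
  conditions on \<open>I\<close>, which turns a constrained extension problem into an unconstrained one.
\<close>
lemma sublinear_cone_infimum:
  fixes q :: "'v::real_vector \<Rightarrow> real" and I :: "('v \<times> real) set"
  assumes q: "sublinear q" and I: "convex_cone I" and le: "\<And>h a. (h, a) \<in> I \<Longrightarrow> a \<le> q h"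
  obtains r where "sublinear r" "\<And>y. r y \<le> q y" "\<And>h a. (h, a) \<in> I \<Longrightarrow> r (- h) \<le> - a"
proof
  define r where "r y = (INF z\<in>I. q (y + fst z) - snd z)" for y
  have ne: "I \<noteq> {}" and zero: "(0, 0) \<in> I"
    using convex_cone_nonempty[OF I] convex_cone_contains_0[OF I] by (auto simp: zero_prod_def)
  have bdd: "bdd_below ((\<lambda>z. q (y + fst z) - snd z) ` I)" for y
  proof (rule bdd_belowI2)
    fix z assume "z \<in> I"
    then have "snd z \<le> q (fst z)" using le[of "fst z" "snd z"] by simp
    also have "\<dots> \<le> q (y + fst z) + q (- y)"
      using sublinearD(1)[OF q, of "y + fst z" "- y"] by simp
    finally show "- q (- y) \<le> q (y + fst z) - snd z" by simp
  qed
  have lower: "r y \<le> q (y + h) - a" if "(h, a) \<in> I" for y h a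
    using cINF_lower[OF bdd that, of y] by (simp add: r_def)
  show "r y \<le> q y" for y
    using lower[OF zero] by simp
  show "r (- h) \<le> - a" if "(h, a) \<in> I" for h a
    using lower[OF that, of "- h"] sublinearD(3)[OF q] by simp
  have greatest: "b \<le> r y" if "\<And>h a. (h, a) \<in> I \<Longrightarrow> b \<le> q (y + h) - a" for b y
    unfolding r_def using that by (intro cINF_greatest[OF ne]) auto
  have "r (x + y) \<le> r x + r y" for x y
  proof -
    have "r (x + y) - (q (x + h) - a) \<le> r y" if ha: "(h, a) \<in> I" for h a
    proof (rule greatest)
      fix g b assume "(g, b) \<in> I"
      then have "(h + g, a + b) \<in> I" using convex_cone_add[OF I ha] by force
      then have "r (x + y) \<le> q ((x + y) + (h + g)) - (a + b)" by (rule lower)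
      also have "q ((x + y) + (h + g)) \<le> q (x + h) + q (y + g)"
        using sublinearD(1)[OF q, of "x + h" "y + g"] by (simp add: algebra_simps)
      finally show "r (x + y) - (q (x + h) - a) \<le> q (y + g) - b" by simp
    qed
    then have "r (x + y) - r y \<le> r x" by (intro greatest) (simp add: algebra_simps)
    then show ?thesis by simp
  qed
  moreover have "r (c *\<^sub>R x) \<le> c * r x" if "0 \<le> c" for c x
  proof (cases "c = 0")
    case True
    then show ?thesis using lower[OF zero, of 0] sublinearD(3)[OF q] by simp
  next
    case False
    with that have c: "0 < c" by simp
    have "r (c *\<^sub>R x) / c \<le> r x"
    proof (rule greatest)
      fix h a assume "(h, a) \<in> I"
      then have "(c *\<^sub>R h, c * a) \<in> I" using convex_cone_scaleR[OF I that] by force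
      then have "r (c *\<^sub>R x) \<le> q (c *\<^sub>R x + c *\<^sub>R h) - c * a" by (rule lower)
      also have "\<dots> \<le> c * (q (x + h) - a)"
        using sublinearD(2)[OF q that, of "x + h"] by (simp add: algebra_simps)
      finally show "r (c *\<^sub>R x) / c \<le> q (x + h) - a"
        using c by (simp add: divide_simps mult.commute)
    qed
    then show ?thesis using c by (simp add: divide_simps mult.commute)
  qed
  ultimately show "sublinear r" by (simp add: sublinear_def)
qed

lemma sublinear_scaleR:
  assumes q: "sublinear q" and c: "0 \<le> c"
  shows "q (c *\<^sub>R x) = c * q x"
proof (cases "c = 0")
  case False
  then have "q x \<le> inverse c * q (c *\<^sub>R x)"
    using sublinearD(2)[OF q, of "inverse c" "c *\<^sub>R x"] c by simp
  then have "c * q x \<le> q (c *\<^sub>R x)"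
    using False c by (simp add: divide_simps mult.commute)
  then show ?thesis using sublinearD(2)[OF q c, of x] by simp
qed (simp add: sublinearD(3)[OF q])

lemma convex_cone_ray: "convex_cone ((\<lambda>t. t *\<^sub>R z) ` {0..})"
  for z :: "'v::real_vector"
proof -
  have "linear (\<lambda>t. t *\<^sub>R z)" by (simp add: linear_iff scaleR_add_left)
  moreover have "convex_cone {0::real..}"
    by (auto simp: convex_cone_def conic_def)
  ultimately show ?thesis using convex_cone_linear_image by blast
qed

text \<open>
  Subject to the single constraint \<open>l x \<ge> q x\<close>, the previous lemma yields a sublinear functional below \<open>q\<close>
  with value at most \<open>- q x\<close> at \<open>- x\<close>. By minimality it is \<open>q\<close>, so \<open>q\<close> is odd, and an odd subadditive
  function is additive.
\<close>
lemma minimal_sublinear_is_linear: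
  fixes q :: "'v::real_vector \<Rightarrow> real"
  assumes q: "sublinear q"
    and minimal: "\<And>r. sublinear r \<Longrightarrow> (\<And>y. r y \<le> q y) \<Longrightarrow> r = q"
  shows "linear q"
proof -
  have neg: "q (- x) = - q x" for x
  proof -
    have "\<And>h a. (h, a) \<in> (\<lambda>t. t *\<^sub>R (x, q x)) ` {0..} \<Longrightarrow> a \<le> q h"
      using sublinear_scaleR[OF q] by auto
    from sublinear_cone_infimum[OF q convex_cone_ray this] obtain r
      where r: "sublinear r" "\<And>y. r y \<le> q y"
        and neg: "\<And>h a. (h, a) \<in> (\<lambda>t. t *\<^sub>R (x, q x)) ` {0..} \<Longrightarrow> r (- h) \<le> - a"
      by metis
    have "(x, q x) \<in> (\<lambda>t. t *\<^sub>R (x, q x)) ` {0..}"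
      by (rule image_eqI[of _ _ 1]) auto
    then have "q (- x) \<le> - q x" using neg minimal[OF r] by metis
    then show ?thesis using sublinearD(4)[OF q, of x] by simp
  qed
  have "q (x + y) = q x + q y" for x y
    using sublinearD(1)[OF q, of x y] sublinearD(1)[OF q, of "x + y" "- y"] neg[of y] by simp
  moreover have "q (c *\<^sub>R x) = c * q x" for c x
  proof (cases "0 \<le> c")
    case False
    then show ?thesis using sublinear_scaleR[OF q, of "- c" x] neg[of "c *\<^sub>R x"] by simp
  qed (rule sublinear_scaleR[OF q])
  ultimately show ?thesis by (simp add: linear_iff)
qed

text \<open>
  Zorn's lemma, ordered downwards, supplies a minimal sublinear functional below \<open>q\<close>. A chain has its
  pointwise infimum as a lower bound, which is finite since every \<open>r \<le> q\<close> satisfies \<open>r x \<ge> - q (- x)\<close>.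
\<close>
lemma sublinear_dominates_linear:
  fixes q :: "'v::real_vector \<Rightarrow> real"
  assumes q: "sublinear q"
  obtains l where "linear l" "\<And>x. l x \<le> q x"
proof -
  let ?A = "{r. sublinear r \<and> (\<forall>x. r x \<le> q x)}"
  let ?P = "\<lambda>r s :: 'v \<Rightarrow> real. \<forall>x. s x \<le> r x"
  have "\<exists>m\<in>?A. \<forall>a\<in>?A. ?P m a \<longrightarrow> a = m"
  proof (rule predicate_Zorn)
    show "partial_order_on ?A (relation_of ?P ?A)"
      by (rule partial_order_on_relation_ofI) (auto intro!: antisym le_funI intro: order_trans)
  next
    fix C assume C: "C \<in> Chains (relation_of ?P ?A)"
    then have chain: "?P r s \<or> ?P s r" if "r \<in> C" "s \<in> C" for r s
      using that unfolding Chains_def relation_of_def by blast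
    have CA: "sublinear r" "r x \<le> q x" if "r \<in> C" for r x
      using C that unfolding Chains_def relation_of_def by blast+
    show "\<exists>u\<in>?A. \<forall>a\<in>C. ?P a u"
    proof (cases "C = {}")
      case True
      then show ?thesis using q by auto
    next
      case False
      define u where "u x = (INF r\<in>C. r x)" for x
      have "- q (- x) \<le> r x" if "r \<in> C" for r x
        using sublinearD(4)[OF CA(1)[OF that], of x] CA(2)[OF that, of "- x"] by simp
      then have "bdd_below ((\<lambda>r. r x) ` C)" for x by (intro bdd_belowI2)
      then have lower: "u x \<le> r x" if "r \<in> C" for r x
        unfolding u_def using that by (rule cINF_lower)
      have greatest: "b \<le> u x" if "\<And>r. r \<in> C \<Longrightarrow> b \<le> r x" for b x
        unfolding u_def using that by (rule cINF_greatest[OF False])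
      have "u (x + y) \<le> u x + u y" for x y
      proof -
        have "u (x + y) - s y \<le> r x" if "r \<in> C" "s \<in> C" for r s
          \<comment> \<open>the smaller one of \<open>r\<close> and \<open>s\<close> serves for both summands\<close>
          using chain[OF that] lower[OF that(1), of "x + y"] lower[OF that(2), of "x + y"]
            sublinearD(1)[OF CA(1)[OF that(1)], of x y] sublinearD(1)[OF CA(1)[OF that(2)], of x y]
          by (smt (verit))
        then have "u (x + y) - s y \<le> u x" if "s \<in> C" for s
          using that by (intro greatest)
        then have "u (x + y) - u x \<le> u y"
          by (intro greatest) (simp add: algebra_simps)
        then show ?thesis by simp
      qed
      moreover have "u (c *\<^sub>R x) \<le> c * u x" if "0 \<le> c" for c x
      proof (cases "c = 0")
        case True
        then show ?thesis using False lower CA(1) sublinearD(3) by (metis ex_in_conv mult_zero_left scaleR_zero_left)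
      next
        case c: False
        have "u (c *\<^sub>R x) / c \<le> u x"
        proof (rule greatest)
          fix r assume r: "r \<in> C"
          have "u (c *\<^sub>R x) \<le> c * r x"
            using lower[OF r, of "c *\<^sub>R x"] sublinearD(2)[OF CA(1)[OF r] that, of x] by simp
          then show "u (c *\<^sub>R x) / c \<le> r x" using c that by (simp add: divide_simps mult.commute)
        qed
        then show ?thesis using c that by (simp add: divide_simps mult.commute)
      qed
      ultimately have "sublinear u" by (simp add: sublinear_def)
      moreover have "u x \<le> q x" for x
        using False lower CA(2) by (meson ex_in_conv order_trans)
      ultimately show ?thesis using lower by auto
    qed
  qed
  then obtain m where m: "sublinear m" "\<And>x. m x \<le> q x"
    and minimal: "\<And>r. sublinear r \<Longrightarrow> (\<And>x. r x \<le> q x) \<Longrightarrow> (\<And>x. r x \<le> m x) \<Longrightarrow> r = m"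
    by blast
  have "linear m"
    by (rule minimal_sublinear_is_linear[OF m(1)]) (meson m(2) minimal order_trans)
  then show ?thesis using m(2) that by blast
qed

text \<open>
  Stated for a convex cone of constraints because its two uses have this form: the cone is a ray for
  \<open>norming_functional\<close>, and it is indexed by finite families of vectors for \<open>Pietsch_domination\<close>.
\<close>
theorem Mazur_Orlicz:
  fixes q :: "'v::real_vector \<Rightarrow> real" and I :: "('v \<times> real) set"
  assumes "sublinear q" "convex_cone I" "\<And>h a. (h, a) \<in> I \<Longrightarrow> a \<le> q h"
  obtains l where "linear l" "\<And>x. l x \<le> q x" "\<And>h a. (h, a) \<in> I \<Longrightarrow> a \<le> l h"
proof -
  obtain r where r: "sublinear r" "\<And>y. r y \<le> q y" "\<And>h a. (h, a) \<in> I \<Longrightarrow> r (- h) \<le> - a"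
    using sublinear_cone_infimum[OF assms] by metis
  obtain l where l: "linear l" "\<And>x. l x \<le> r x"
    using sublinear_dominates_linear[OF r(1)] by metis
  have "a \<le> l h" if "(h, a) \<in> I" for h a
    using l(2)[of "- h"] r(3)[OF that] linear_neg[OF l(1), of h] by simp
  then show ?thesis using that l r(2) by (meson order_trans)
qed

text \<open>The Hahn-Banach theorem for one vector: the constraint is imposed on the ray through \<open>e\<close>.\<close>
corollary norming_functional:
  fixes e :: "'a::real_normed_vector"
  obtains l where "linear l" "\<And>x. \<bar>l x\<bar> \<le> norm x" "l e = norm e"
proof -
  have "sublinear (norm :: 'a \<Rightarrow> real)"
    by (simp add: sublinear_def norm_triangle_ineq)
  moreover have "\<And>h a. (h, a) \<in> (\<lambda>t. t *\<^sub>R (e, norm e)) ` {0..} \<Longrightarrow> a \<le> norm h"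
    by auto
  ultimately obtain l :: "'a \<Rightarrow> real" where l: "linear l" "\<And>x. l x \<le> norm x"
    and e: "\<And>h a. (h, a) \<in> (\<lambda>t. t *\<^sub>R (e, norm e)) ` {0..} \<Longrightarrow> a \<le> l h"
    using Mazur_Orlicz[OF _ convex_cone_ray] by metis
  have "\<bar>l x\<bar> \<le> norm x" for x
    using l(2)[of x] l(2)[of "- x"] linear_neg[OF l(1), of x] by simp
  moreover have "(e, norm e) \<in> (\<lambda>t. t *\<^sub>R (e, norm e)) ` {0..}"
    by (rule image_eqI[of _ _ 1]) auto
  then have "l e = norm e" using e l(2)[of e] by (simp add: antisym)
  ultimately show ?thesis using that l(1) by blast
qed

section \<open>Spaces with a 2-summing identity are finite dimensional\<close>

text \<open>
  Gram-Schmidt for an inner product that is not the one of a type class. It starts from the vectors of a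
  finite independent set, so that it applies inside an infinite-dimensional space. That the \<open>e i\<close> stay in
  the span of \<open>B\<close> is what makes the next vector nonzero.
\<close>
lemma orthonormal_family_exists:
  fixes \<beta> :: "'a::real_vector \<Rightarrow> 'a \<Rightarrow> real"
  assumes lin: "\<And>x. linear (\<beta> x)" and sym: "\<And>x y. \<beta> x y = \<beta> y x"
    and pos: "\<And>x. x \<noteq> 0 \<Longrightarrow> 0 < \<beta> x x"
    and "finite B" "independent B"
  shows "\<exists>e. (\<forall>i<card B. e i \<in> span B) \<and>
             (\<forall>i<card B. \<forall>j<card B. \<beta> (e i) (e j) = (if i = j then 1 else 0))"
  using \<open>finite B\<close> \<open>independent B\<close>
proof (induction B)
  case (insert v B)
  have v: "v \<notin> span B" and B: "independent B"
    using insert.prems insert.hyps by (auto simp: independent_insert)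
  define d where "d = card B"
  obtain e where e: "\<And>i. i < d \<Longrightarrow> e i \<in> span B"
    and ortho: "\<And>i j. i < d \<Longrightarrow> j < d \<Longrightarrow> \<beta> (e i) (e j) = (if i = j then 1 else 0)"
    using insert.IH[OF B] unfolding d_def by blast
  define w where "w = v - (\<Sum>i<d. \<beta> (e i) v *\<^sub>R e i)"
  have sum: "(\<Sum>i<d. \<beta> (e i) v *\<^sub>R e i) \<in> span B"
    using e by (auto intro: span_sum span_scale)
  then have "w \<noteq> 0" using v by (auto simp: w_def)
  then have w: "0 < \<beta> w w" by (rule pos)
  have ew: "\<beta> (e j) w = 0" if "j < d" for j
  proof -
    have "\<beta> (e j) w = \<beta> (e j) v - (\<Sum>i<d. \<beta> (e i) v * \<beta> (e j) (e i))"
      by (simp add: w_def linear_diff[OF lin] linear_sum[OF lin] linear_scale[OF lin])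
    also have "(\<Sum>i<d. \<beta> (e i) v * \<beta> (e j) (e i)) = (\<Sum>i<d. if i = j then \<beta> (e i) v else 0)"
      using that by (intro sum.cong) (auto simp: ortho)
    finally show ?thesis using that by simp
  qed
  have we: "\<beta> w (e j) = 0" if "j < d" for j
    using ew[OF that] sym[of w "e j"] by simp
  define e' where "e' = e(d := w /\<^sub>R sqrt (\<beta> w w))"
  have scale2: "\<beta> (c *\<^sub>R x) y = c * \<beta> x y" for c x y
    using linear_scale[OF lin[of y], of c x] sym by simp
  have "w \<in> span (insert v B)"
    unfolding w_def using sum span_mono[OF subset_insertI[of B v]]
    by (intro span_diff) (auto intro: span_base)
  then have "e' i \<in> span (insert v B)" if "i < Suc d" for i
    using that e span_mono[OF subset_insertI[of B v]]
    by (auto simp: e'_def less_Suc_eq span_scale)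
  moreover have "\<beta> (e' i) (e' j) = (if i = j then 1 else 0)" if "i < Suc d" "j < Suc d" for i j
    using that w ew we
    by (auto simp: e'_def less_Suc_eq ortho scale2 linear_scale[OF lin] field_simps)
  ultimately show ?case
    using insert.hyps by (intro exI[of _ e']) (simp add: d_def)
qed simp

text \<open>
  Evaluation at \<open>x\<close> is unbounded on the dual space. With \<open>F\<close> replaced by \<open>F / max 1 \<parallel>F\<parallel>\<close>, which runs through
  the closed dual unit ball and varies continuously, the whole dual space parametrizes its unit ball, and
  evaluation becomes a bounded continuous function.
\<close>
definition pairing :: "'a::real_normed_vector \<Rightarrow> ('a \<Rightarrow>\<^sub>L real) \<Rightarrow> real" where
  "pairing x F = blinfun_apply F x / max 1 (norm F)"

lemma linear_pairing: "linear (\<lambda>x. pairing x F)"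
  by (simp add: linear_iff pairing_def blinfun.add_right blinfun.scaleR_right add_divide_distrib)

lemma abs_pairing_le: "\<bar>pairing x F\<bar> \<le> norm x"
proof -
  have "\<bar>blinfun_apply F x\<bar> \<le> norm F * norm x"
    using norm_blinfun[of F x] by simp
  also have "\<dots> \<le> max 1 (norm F) * norm x"
    by (intro mult_right_mono) auto
  finally show ?thesis by (simp add: pairing_def divide_simps mult.commute)
qed

lemma pairing_surj:
  assumes "linear f" "\<And>x. \<bar>f x\<bar> \<le> norm x"
  obtains F where "\<And>x. pairing x F = f x"
proof
  have "bounded_linear f"
    using assms by (intro bounded_linear.intro bounded_linear_axioms.intro exI[of _ 1]) auto
  moreover from this have "norm (Blinfun f) \<le> 1"
    using assms(2) by (intro norm_blinfun_bound) (auto simp: bounded_linear_Blinfun_apply)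
  ultimately show "pairing x (Blinfun f) = f x" for x
    by (simp add: pairing_def bounded_linear_Blinfun_apply max_def)
qed

definition product_form :: "'a::real_normed_vector \<Rightarrow> 'a \<Rightarrow> ('a \<Rightarrow>\<^sub>L real) \<Rightarrow>\<^sub>C real" where
  "product_form x y = Bcontfun (\<lambda>F. pairing x F * pairing y F)"

lemma apply_product_form: "apply_bcontfun (product_form x y) F = pairing x F * pairing y F"
proof -
  have "(\<lambda>F. pairing x F * pairing y F) \<in> bcontfun"
  proof (rule bcontfun_normI)
    show "continuous_on UNIV (\<lambda>F. pairing x F * pairing y F)"
      unfolding pairing_def by (intro continuous_intros) auto
    show "norm (pairing x F * pairing y F) \<le> norm x * norm y" for F
      by (simp add: abs_mult mult_mono abs_pairing_le)
  qed
  then show ?thesis by (simp add: product_form_def Bcontfun_inverse)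
qed

lemma product_form_linear:
  "product_form x (y + z) = product_form x y + product_form x z"
  "product_form x (c *\<^sub>R y) = c *\<^sub>R product_form x y"
  using linear_add[OF linear_pairing, of y z] linear_scale[OF linear_pairing, of c y]
  by (auto intro!: bcontfun_eqI simp: apply_product_form algebra_simps)

lemma product_form_commute: "product_form x y = product_form y x"
  by (rule bcontfun_eqI) (simp add: apply_product_form mult.commute)

lemma bdd_above_bcontfun: "bdd_above (range (apply_bcontfun g))"
  for g :: "'x::topological_space \<Rightarrow>\<^sub>C real"
proof (rule bdd_aboveI2)
  show "apply_bcontfun g x \<le> norm g" for x
    using norm_bounded[of g x] by simp
qed

text \<open>A linear functional below the supremum is a mean: monotone, and bounded by 1 at the constant 1.\<close>
lemma sublinear_SUP: "sublinear (\<lambda>g :: 'x::topological_space \<Rightarrow>\<^sub>C real. SUP F. apply_bcontfun g F)"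
proof -
  have upper: "apply_bcontfun g F \<le> (SUP F. apply_bcontfun g F)" for g :: "'x \<Rightarrow>\<^sub>C real" and F
    by (rule cSUP_upper[OF UNIV_I bdd_above_bcontfun])
  show ?thesis
    unfolding sublinear_def by (auto intro!: cSUP_least add_mono mult_left_mono upper)
qed

lemma bcontfun_sum_list: "apply_bcontfun (\<Sum>x\<leftarrow>xs. h x) F = (\<Sum>x\<leftarrow>xs. apply_bcontfun (h x) F)"
  for h :: "'b \<Rightarrow> 'x::topological_space \<Rightarrow>\<^sub>C real"
  by (induction xs) auto

lemma bcontfun_sum: "apply_bcontfun (\<Sum>x\<in>A. h x) F = (\<Sum>x\<in>A. apply_bcontfun (h x) F)"
  for h :: "'b \<Rightarrow> 'x::topological_space \<Rightarrow>\<^sub>C real"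
  by (induction A rule: infinite_finite_induct) auto

text \<open>
  The identity is absolutely 2-summing with constant \<open>sqrt C\<close>. An upper bound \<open>M\<close> takes the place of the
  supremum over the dual ball, which avoids conditions for its existence; a family of vectors is a
  list, so that families are concatenated by \<open>@\<close>.
\<close>
definition two_summing_identity :: "real \<Rightarrow> 'a::real_normed_vector itself \<Rightarrow> bool" where
  "two_summing_identity C _ \<longleftrightarrow>
     (\<forall>(xs :: 'a list) M.
        (\<forall>f. linear f \<longrightarrow> (\<forall>x. \<bar>f x\<bar> \<le> norm x) \<longrightarrow> (\<Sum>x\<leftarrow>xs. (f x)\<^sup>2) \<le> M) \<longrightarrow>
        (\<Sum>x\<leftarrow>xs. (norm x)\<^sup>2) \<le> C * M)"

lemma two_summing_identityD:
  fixes xs :: "'a::real_normed_vector list"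
  assumes "two_summing_identity C TYPE('a)"
    and "\<And>f. linear f \<Longrightarrow> (\<And>x. \<bar>f x\<bar> \<le> norm x) \<Longrightarrow> (\<Sum>x\<leftarrow>xs. (f x)\<^sup>2) \<le> M"
  shows "(\<Sum>x\<leftarrow>xs. (norm x)\<^sup>2) \<le> C * M"
  using assms unfolding two_summing_identity_def by blast

text \<open>
  The pairs \<open>(C \<Sum> F(x)\<^sup>2, \<Sum> \<parallel>x\<parallel>\<^sup>2)\<close>, over all finite families of vectors \<open>x\<close>, form a convex cone:
  concatenation of families adds them, and scaling the vectors by \<open>sqrt c\<close> multiplies them by \<open>c\<close>. That the
  identity is 2-summing says precisely that on this cone the second entry is at most the supremum of the
  first. So Mazur-Orlicz applies, and families of one vector give the domination.
\<close>
lemma Pietsch_domination: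
  assumes C: "0 \<le> C" and summing: "two_summing_identity C TYPE('a::real_normed_vector)"
  obtains l :: "(('a::real_normed_vector \<Rightarrow>\<^sub>L real) \<Rightarrow>\<^sub>C real) \<Rightarrow> real"
  where "linear l" "\<And>g a. (\<And>F. apply_bcontfun g F \<le> a) \<Longrightarrow> l g \<le> a"
    "\<And>x. (norm x)\<^sup>2 \<le> C * l (product_form x x)"
proof -
  define z where "z xs = (\<Sum>x\<leftarrow>xs. (C *\<^sub>R product_form x x, (norm x)\<^sup>2))" for xs :: "'a list"
  have z_fst: "fst (z xs) = (\<Sum>x\<leftarrow>xs. C *\<^sub>R product_form x x)" for xs
    by (induction xs) (auto simp: z_def)
  have z_snd: "snd (z xs) = (\<Sum>x\<leftarrow>xs. (norm x)\<^sup>2)" for xs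
    by (induction xs) (auto simp: z_def)
  have "convex_cone (range z)"
    unfolding convex_cone_iff
  proof (intro conjI ballI allI impI; (elim rangeE; simp only:)?)
    show "0 \<in> range z"
      by (rule range_eqI[of _ _ "[]"]) (simp add: z_def)
    show "z xs + z ys \<in> range z" for xs ys
      by (rule range_eqI[of _ _ "xs @ ys"]) (simp add: z_def)
    show "c *\<^sub>R z xs \<in> range z" if "0 \<le> c" for c xs
    proof (rule range_eqI)
      have "z (map ((*\<^sub>R) (sqrt c)) xs) = c *\<^sub>R z xs"
      proof (induction xs)
        case (Cons x xs)
        have "product_form (sqrt c *\<^sub>R x) (sqrt c *\<^sub>R x) = c *\<^sub>R product_form x x"
          using that by (simp add: product_form_linear product_form_commute[of "sqrt c *\<^sub>R x"])
        then show ?case using Cons that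
          by (simp add: z_def algebra_simps)
      qed (simp add: z_def)
      then show "c *\<^sub>R z xs = z (map ((*\<^sub>R) (sqrt c)) xs)" by simp
    qed
  qed
  moreover have "a \<le> (SUP F. apply_bcontfun h F)" if "(h, a) \<in> range z" for h a
  proof -
    from that obtain xs where "(h, a) = z xs" by blast
    then have xs: "h = (\<Sum>x\<leftarrow>xs. C *\<^sub>R product_form x x)" "a = (\<Sum>x\<leftarrow>xs. (norm x)\<^sup>2)"
      using z_fst[of xs] z_snd[of xs] by (metis fst_conv, metis snd_conv)
    have h: "apply_bcontfun h F = C * (\<Sum>x\<leftarrow>xs. (pairing x F)\<^sup>2)" for F
      by (simp add: xs bcontfun_sum_list apply_product_form power2_eq_square sum_list_const_mult)
    define g where "g = (\<Sum>x\<leftarrow>xs. product_form x x)"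
    have g: "apply_bcontfun g F = (\<Sum>x\<leftarrow>xs. (pairing x F)\<^sup>2)" for F
      by (simp add: g_def bcontfun_sum_list apply_product_form power2_eq_square)
    have "h = C *\<^sub>R g" by (rule bcontfun_eqI) (simp add: h g)
    have "a \<le> C * (SUP F. apply_bcontfun g F)"
      unfolding xs
    proof (rule two_summing_identityD[OF summing])
      fix f :: "'a \<Rightarrow> real" assume "linear f" "\<And>x. \<bar>f x\<bar> \<le> norm x"
      then obtain F where "\<And>x. pairing x F = f x" using pairing_surj by metis
      then have "(\<Sum>x\<leftarrow>xs. (f x)\<^sup>2) = apply_bcontfun g F" by (simp add: g)
      also have "\<dots> \<le> (SUP F. apply_bcontfun g F)"
        by (rule cSUP_upper[OF UNIV_I bdd_above_bcontfun])
      finally show "(\<Sum>x\<leftarrow>xs. (f x)\<^sup>2) \<le> (SUP F. apply_bcontfun g F)" .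
    qed
    also have "\<dots> = (SUP F. apply_bcontfun h F)"
      using sublinear_scaleR[OF sublinear_SUP C, of g] by (simp add: \<open>h = C *\<^sub>R g\<close>)
    finally show ?thesis .
  qed
  ultimately obtain l where l: "linear l" "\<And>g. l g \<le> (SUP F. apply_bcontfun g F)"
    and cone: "\<And>h a. (h, a) \<in> range z \<Longrightarrow> a \<le> l h"
    using Mazur_Orlicz[OF sublinear_SUP] by metis
  show ?thesis
  proof
    show "linear l" by (rule l)
    show "l g \<le> a" if "\<And>F. apply_bcontfun g F \<le> a" for g a
      using l(2)[of g] that by (intro order_trans[OF l(2)] cSUP_least) auto
    show "(norm x)\<^sup>2 \<le> C * l (product_form x x)" for x
    proof -
      have "(C *\<^sub>R product_form x x, (norm x)\<^sup>2) \<in> range z"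
        by (rule range_eqI[of _ _ "[x]"]) (simp add: z_def)
      from cone[OF this] show ?thesis by (simp add: linear_scale[OF l(1)])
    qed
  qed
qed

text \<open>
  With \<open>s = \<Sum>\<^sub>i F(e\<^sub>i)\<^sup>2\<close> and \<open>x = \<Sum>\<^sub>i F(e\<^sub>i) e\<^sub>i\<close> one has both \<open>F(x) = s\<close> and \<open>\<beta>(x,x) = s\<close>. Hence
  \<open>s\<^sup>2 \<le> \<parallel>x\<parallel>\<^sup>2 \<le> C s\<close>, that is \<open>s \<le> C\<close>, for every \<open>F\<close>, while the mean of \<open>s\<close> over \<open>F\<close> is the
  number of vectors.
\<close>
lemma two_summing_identity_card_independent_le:
  fixes B :: "'a::real_normed_vector set"
  assumes C: "0 \<le> C" and summing: "two_summing_identity C TYPE('a)"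
    and B: "finite B" "independent B"
  shows "real (card B) \<le> C"
proof -
  obtain l :: "(('a \<Rightarrow>\<^sub>L real) \<Rightarrow>\<^sub>C real) \<Rightarrow> real" where l: "linear l"
    and mean: "\<And>g a. (\<And>F. apply_bcontfun g F \<le> a) \<Longrightarrow> l g \<le> a"
    and dom: "\<And>x. (norm x)\<^sup>2 \<le> C * l (product_form x x)"
    using Pietsch_domination[OF C summing] by metis
  define \<beta> where "\<beta> x y = l (product_form x y)" for x y
  have lin: "linear (\<beta> x)" for x
    by (simp add: linear_iff \<beta>_def product_form_linear linear_add[OF l] linear_scale[OF l])
  have sym: "\<beta> x y = \<beta> y x" for x y
    by (simp add: \<beta>_def product_form_commute[of x])
  have pos: "0 < \<beta> x x" if "x \<noteq> 0" for x
  proof -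
    have "0 < C * \<beta> x x"
      using that dom[of x] unfolding \<beta>_def by (smt (verit) zero_less_norm_iff zero_less_power)
    then show ?thesis using C by (simp add: zero_less_mult_iff)
  qed
  obtain e where ortho: "\<And>i j. i < card B \<Longrightarrow> j < card B \<Longrightarrow> \<beta> (e i) (e j) = (if i = j then 1 else 0)"
    using orthonormal_family_exists[of \<beta>, OF lin sym pos B] by blast
  let ?d = "card B"
  have bound: "(\<Sum>i<?d. (pairing (e i) F)\<^sup>2) \<le> C" for F
  proof -
    define s where "s = (\<Sum>i<?d. (pairing (e i) F)\<^sup>2)"
    define x where "x = (\<Sum>i<?d. pairing (e i) F *\<^sub>R e i)"
    have s0: "0 \<le> s" by (simp add: s_def sum_nonneg)
    have ex: "\<beta> (e j) x = pairing (e j) F" if "j < ?d" for j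
    proof -
      have "\<beta> (e j) x = (\<Sum>i<?d. pairing (e i) F * \<beta> (e j) (e i))"
        by (simp add: x_def linear_sum[OF lin] linear_scale[OF lin])
      also have "\<dots> = (\<Sum>i<?d. if i = j then pairing (e i) F else 0)"
        using that by (intro sum.cong) (auto simp: ortho)
      finally show ?thesis using that by simp
    qed
    have "\<beta> x x = (\<Sum>i<?d. pairing (e i) F * \<beta> x (e i))"
      by (subst (2) x_def) (simp add: linear_sum[OF lin] linear_scale[OF lin])
    also have "\<dots> = s"
      unfolding s_def by (intro sum.cong) (auto simp: sym[of x "e _"] ex power2_eq_square)
    finally have "\<beta> x x = s" .
    moreover have "pairing x F = s"
      by (simp add: x_def s_def linear_sum[OF linear_pairing] linear_scale[OF linear_pairing] power2_eq_square)
    then have "s \<le> norm x" using abs_pairing_le[of x F] by simp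
    then have "s\<^sup>2 \<le> (norm x)\<^sup>2" using s0 by (intro power_mono)
    ultimately have "s * s \<le> C * s" using dom[of x] by (simp add: \<beta>_def power2_eq_square)
    then show ?thesis using s0 C unfolding s_def[symmetric]
      by (cases "s = 0") (auto simp: mult_le_cancel_right)
  qed
  have "real ?d = (\<Sum>i<?d. \<beta> (e i) (e i))" by (simp add: ortho)
  also have "\<dots> = l (\<Sum>i<?d. product_form (e i) (e i))"
    by (simp add: \<beta>_def linear_sum[OF l])
  also have "\<dots> \<le> C"
    using bound by (intro mean) (simp add: bcontfun_sum apply_product_form power2_eq_square)
  finally show ?thesis .
qed

theorem two_summing_identity_imp_finite_span:
  assumes "0 \<le> C" "two_summing_identity C TYPE('a::real_normed_vector)"
  obtains B :: "'a::real_normed_vector set" where "finite B" "span B = UNIV"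
proof -
  obtain B :: "'a set" where B: "independent B" "UNIV \<subseteq> span B"
    using maximal_independent_subset[of "UNIV :: 'a set"] by (metis (no_types))
  have "finite B"
  proof (rule ccontr)
    assume "infinite B"
    then obtain A where A: "A \<subseteq> B" "finite A" "card A = Suc (nat \<lceil>C\<rceil>)"
      using infinite_arbitrarily_large by blast
    then have "real (card A) \<le> C"
      using assms B by (intro two_summing_identity_card_independent_le) (auto dest: real_vector.independent_mono)
    then show False using A(3) by linarith
  qed
  then show ?thesis using that B by blast
qed

section \<open>Functionals and forms over the scalar field\<close>

context banach_space_over
begin

lemma vector_space_scalars: "vector_space ((*) :: 'k \<Rightarrow> 'k \<Rightarrow> 'k)"
  by unfold_locales (simp_all add: algebra_simps)

lemma linear_form_iff:
  "Vector_Spaces.linear scale (*) f \<longleftrightarrow>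
    (\<forall>x y. f (x + y) = f x + f y) \<and> (\<forall>c x. f (scale c x) = c * f x)"
  using vector_space_axioms vector_space_scalars by (simp add: Vector_Spaces.linear_iff)

lemma linear_operator_iff:
  "Vector_Spaces.linear scale scale f \<longleftrightarrow>
    (\<forall>x y. f (x + y) = f x + f y) \<and> (\<forall>c x. f (scale c x) = scale c (f x))"
  using vector_space_axioms by (simp add: Vector_Spaces.linear_iff)

definition bounded_functional :: "('a \<Rightarrow> 'k) \<Rightarrow> bool" where
  "bounded_functional f \<longleftrightarrow>
     Vector_Spaces.linear scale (*) f \<and> (\<exists>K. \<forall>x. norm (f x) \<le> K * norm x)"

lemma bounded_functionalD:
  assumes "bounded_functional f"
  shows "f (x + y) = f x + f y" "f (scale c x) = c * f x" "f 0 = 0" "f (x - y) = f x - f y"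
proof -
  show add: "f (x + y) = f x + f y" and "f (scale c x) = c * f x" for x y c
    using assms by (auto simp: bounded_functional_def linear_form_iff)
  show "f 0 = 0" using add[of 0 0] by simp
  show "f (x - y) = f x - f y" using add[of "x - y" y] by simp
qed

lemma bounded_functional_bound:
  assumes "bounded_functional f"
  obtains K where "0 < K" "\<And>x. norm (f x) \<le> K * norm x"
proof -
  obtain K where K: "\<And>x. norm (f x) \<le> K * norm x"
    using assms by (auto simp: bounded_functional_def)
  have "norm (f x) \<le> (\<bar>K\<bar> + 1) * norm x" for x
    by (rule order_trans[OF K]) (intro mult_right_mono; simp)
  then show ?thesis by (intro that[of "\<bar>K\<bar> + 1"]) auto
qed

definition contraction :: "('a \<Rightarrow> 'k) \<Rightarrow> bool" where
  "contraction f \<longleftrightarrow> Vector_Spaces.linear scale (*) f \<and> (\<forall>x. norm (f x) \<le> norm x)"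

lemma form_ballI:
  fixes \<phi> :: "('n::finite \<Rightarrow> 'a) \<Rightarrow> 'k"
  assumes lin: "\<And>x i. Vector_Spaces.linear scale (*) (\<lambda>y. \<phi> (x(i := y)))"
    and le: "\<And>x. norm (\<phi> x) \<le> (\<Prod>i\<in>UNIV. norm (x i))"
  shows "\<phi> \<in> form_ball scale"
proof -
  have "{x :: 'n \<Rightarrow> 'a. \<forall>i. norm (x i) \<le> 1} \<noteq> {}"
    by (auto intro!: exI[of _ "\<lambda>_. 0"])
  moreover have "norm (\<phi> x) \<le> 1" if "\<forall>i. norm (x i) \<le> 1" for x
    using that by (intro order_trans[OF le] prod_le_1) auto
  ultimately have "multilinear_norm \<phi> \<le> 1"
    unfolding multilinear_norm_def by (intro cSUP_least) auto
  moreover have "\<exists>K. \<forall>x. norm (\<phi> x) \<le> (\<Prod>i\<in>UNIV. norm (x i)) * K"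
    using le by (intro exI[of _ 1]) simp
  ultimately show ?thesis
    using lin by (simp add: form_ball_def bounded_multilinear_def)
qed

text \<open>
  The factor \<open>R\<close> bounds the norm of the form \<open>f \<circ> T\<close>; it is kept positive so that one can divide by it.
\<close>
lemma form_of_operator:
  fixes T :: "('n::finite \<Rightarrow> 'a) \<Rightarrow> 'a"
  assumes T: "T \<in> bounded_multilinear scale scale" and f: "bounded_functional f"
  obtains R where "0 < R" "(\<lambda>x. f (T x) / of_real R) \<in> form_ball scale"
proof -
  obtain K where K: "\<And>x. norm (T x) \<le> (\<Prod>i\<in>UNIV. norm (x i)) * K"
    using T by (auto simp: bounded_multilinear_def)
  obtain L where L: "0 < L" "\<And>x. norm (f x) \<le> L * norm x"
    using bounded_functional_bound[OF f] by metis
  define R where "R = L * (\<bar>K\<bar> + 1)"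
  have R: "0 < R" using L by (simp add: R_def)
  have "(\<lambda>x. f (T x) / of_real R) \<in> form_ball scale"
  proof (rule form_ballI)
    show "Vector_Spaces.linear scale (*) (\<lambda>y. f (T (x(i := y))) / of_real R)" for x i
    proof -
      have "Vector_Spaces.linear scale scale (\<lambda>y. T (x(i := y)))"
        using T by (simp add: bounded_multilinear_def)
      then show ?thesis
        by (simp add: linear_form_iff linear_operator_iff bounded_functionalD[OF f] add_divide_distrib)
    qed
    show "norm (f (T x) / of_real R) \<le> (\<Prod>i\<in>UNIV. norm (x i))" for x
    proof -
      have "norm (f (T x)) \<le> L * ((\<Prod>i\<in>UNIV. norm (x i)) * K)"
        using L K[of x] by (meson mult_left_mono less_imp_le order_trans)
      also have "\<dots> \<le> L * ((\<Prod>i\<in>UNIV. norm (x i)) * (\<bar>K\<bar> + 1))"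
        using L by (intro mult_left_mono prod_nonneg) auto
      also have "\<dots> = (\<Prod>i\<in>UNIV. norm (x i)) * R"
        by (simp add: R_def)
      finally show ?thesis
        using R by (simp add: norm_divide divide_simps)
    qed
  qed
  then show ?thesis using R that by blast
qed

end

section \<open>Summing operators and the dimension\<close>

lemma sum_list_eq_sum_atLeast1: "(\<Sum>x\<leftarrow>xs. g x) = (\<Sum>i=1..length xs. g (xs ! (i - 1)))"
  for g :: "'a \<Rightarrow> 'b::comm_monoid_add"
  by (simp add: sum_list_sum_nth sum.atLeast1_atMost_eq atLeast0LessThan)

text \<open>The left-hand side is \<open>a\<^sup>2 (b / a)\<^sup>p\<close>, and \<open>(b / a)\<^sup>p \<le> b / a\<close> since \<open>b / a \<le> 1 \<le> p\<close>.\<close>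
lemma rescaled_powr_le:
  fixes a b p :: real
  assumes p: "1 \<le> p" and b: "0 \<le> b" "b \<le> a"
  shows "(a powr (2 / p - 1) * b) powr p \<le> a * b"
proof (cases "a = 0")
  case False
  with b have a: "0 < a" by simp
  have "(a powr (2 / p - 1) * b) powr p = (a powr (2 / p) * (b / a)) powr p"
    using a by (simp add: powr_diff)
  also have "\<dots> = (a powr (2 / p)) powr p * (b / a) powr p"
    by (rule powr_mult)
  also have "(a powr (2 / p)) powr p = a\<^sup>2"
    using a p by (simp add: powr_powr)
  also have "a\<^sup>2 * (b / a) powr p \<le> a\<^sup>2 * (b / a) powr 1"
    using a b p by (intro mult_left_mono powr_mono') auto
  also have "\<dots> = a * b" using a b by (simp add: power2_eq_square)
  finally show ?thesis .
qed (use b in simp)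

text \<open>
  The two properties of the real and the complex field on which the proof depends: there are bounded
  functionals that do not vanish at a given nonzero vector, and a functional of norm at most one consists
  of two real-linear ones, its real and imaginary part. Everything else is uniform in the scalar field.
\<close>
locale banach_space_over_RC = banach_space_over scale
  for scale :: "'k::real_normed_field \<Rightarrow> 'a::banach \<Rightarrow> 'a" +
  assumes functional_exists: "w \<noteq> 0 \<Longrightarrow> \<exists>f. bounded_functional f \<and> f w = 1"
    and contraction_parts: "contraction f \<Longrightarrow>
      \<exists>g h. linear g \<and> linear h \<and>
        (\<forall>x. (norm (f x))\<^sup>2 = (g x)\<^sup>2 + (h x)\<^sup>2 \<and> \<bar>g x\<bar> \<le> norm x \<and> \<bar>h x\<bar> \<le> norm x)"
begin

text \<open>
  Bounded coordinates without a compactness argument. Suppose that \<open>P\<close> is bounded, of finite rank and the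
  identity on the span of \<open>B\<close>. On the span of \<open>B\<close> and \<open>v\<close> its defect \<open>y - P y\<close> is a multiple of
  \<open>w = v - P v\<close>. If \<open>g w = 1\<close>, then \<open>y \<mapsto> P y + g (y - P y) w\<close> is the identity on the larger span.
\<close>
lemma finite_coordinates:
  assumes "finite B"
  shows "\<exists>(m::nat) f b. (\<forall>j<m. bounded_functional (f j)) \<and>
           (\<forall>y\<in>span B. y = (\<Sum>j<m. scale (f j y) (b j)))"
  using assms
proof (induction B)
  case empty
  then show ?case by (auto intro!: exI[of _ 0])
next
  case (insert v B)
  then obtain m :: nat and f b where f: "\<And>j. j < m \<Longrightarrow> bounded_functional (f j)"
    and coord: "\<And>y. y \<in> span B \<Longrightarrow> y = (\<Sum>j<m. scale (f j y) (b j))"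
    by blast
  define P where "P y = (\<Sum>j<m. scale (f j y) (b j))" for y
  define w where "w = v - P v"
  have P_add: "P (x + y) = P x + P y" and P_scale: "P (scale c x) = scale c (P x)" for x y c
    by (simp_all add: P_def bounded_functionalD[OF f] scale_left_distrib sum.distrib scale_sum_right)
  have defect: "\<exists>k. y - P y = scale k w" if y: "y \<in> span (insert v B)" for y
  proof -
    obtain k where k: "y - scale k v \<in> span B"
      using y by (auto simp: span_breakdown_eq)
    have "P y = P (y - scale k v) + scale k (P v)"
      using P_add[of "y - scale k v" "scale k v"] by (simp add: P_scale)
    also have "P (y - scale k v) = y - scale k v"
      using coord[OF k] by (simp add: P_def)
    finally have "P y = (y - scale k v) + scale k (P v)" .
    then show ?thesis
      by (intro exI[of _ k]) (simp add: w_def scale_right_diff_distrib)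
  qed
  show ?case
  proof (cases "w = 0")
    case True
    then have "y = P y" if "y \<in> span (insert v B)" for y
      using defect[OF that] by auto
    then show ?thesis using f unfolding P_def by blast
  next
    case False
    then obtain g where g: "bounded_functional g" "g w = 1"
      using functional_exists by blast
    define f' where "f' = f(m := \<lambda>y. g (y - P y))"
    define b' where "b' = b(m := w)"
    have "bounded_functional (\<lambda>y. g (y - P y))"
    proof -
      obtain L where L: "0 < L" "\<And>x. norm (g x) \<le> L * norm x"
        using bounded_functional_bound[OF g(1)] by metis
      have "\<exists>K. \<forall>x. norm (f j x) \<le> K * norm x" if "j < m" for j
        using f[OF that] by (auto simp: bounded_functional_def)
      then obtain K where K: "\<And>j x. j < m \<Longrightarrow> norm (f j x) \<le> K j * norm x"
        by metis
      have "norm (g (y - P y)) \<le> (L * (1 + (\<Sum>j<m. K j * norm (b j)))) * norm y" for y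
      proof -
        have "norm (P y) \<le> (\<Sum>j<m. norm (scale (f j y) (b j)))"
          unfolding P_def by (rule norm_sum)
        also have "\<dots> \<le> (\<Sum>j<m. K j * norm y * norm (b j))"
          by (intro sum_mono) (simp add: norm_scale K mult_right_mono)
        finally have "norm (P y) \<le> (\<Sum>j<m. K j * norm (b j)) * norm y"
          by (simp add: sum_distrib_left ac_simps)
        then have "norm (y - P y) \<le> (1 + (\<Sum>j<m. K j * norm (b j))) * norm y"
          using norm_triangle_ineq4[of y "P y"] by (simp add: algebra_simps)
        then have "L * norm (y - P y) \<le> L * ((1 + (\<Sum>j<m. K j * norm (b j))) * norm y)"
          using L(1) by (intro mult_left_mono) auto
        then show ?thesis using L(2)[of "y - P y"] by (simp only: mult.assoc)
      qed
      moreover have "g (x + y - P (x + y)) = g (x - P x) + g (y - P y)" for x y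
        by (simp add: P_add bounded_functionalD[OF g(1)] algebra_simps)
      moreover have "g (scale c x - P (scale c x)) = c * g (x - P x)" for c x
        by (simp add: P_scale bounded_functionalD[OF g(1)] flip: scale_right_diff_distrib)
      ultimately show ?thesis
        unfolding bounded_functional_def linear_form_iff by blast
    qed
    then have "\<forall>j<Suc m. bounded_functional (f' j)"
      using f by (auto simp: f'_def less_Suc_eq)
    moreover have "y = (\<Sum>j<Suc m. scale (f' j y) (b' j))" if y: "y \<in> span (insert v B)" for y
    proof -
      obtain k where k: "y - P y = scale k w" using defect[OF y] by blast
      then have "scale (g (y - P y)) w = y - P y"
        by (simp add: bounded_functionalD[OF g(1)] g(2))
      then show ?thesis by (simp add: f'_def b'_def flip: P_def)
    qed
    ultimately show ?thesis by blast
  qed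
qed

text \<open>
  At each pair of points, \<open>T u - T v\<close> is at most \<open>W\<close> times the largest coordinate difference of the \<open>m\<close>
  normalized forms, and the \<open>p\<close>-th power of the largest is at most the sum of the \<open>p\<close>-th powers. Exchanging
  the sums leaves \<open>m\<close> terms, each bounded by the \<open>p\<close>-th power of the supremum.
\<close>
theorem finite_span_imp_summing:
  fixes T :: "('n::finite \<Rightarrow> 'a) \<Rightarrow> 'a"
  assumes p: "1 \<le> p" and B: "finite B" "span B = UNIV"
    and T: "T \<in> bounded_multilinear scale scale"
  shows "T \<in> Lipschitz_summing p scale scale"
proof -
  obtain m :: nat and f b where f: "\<And>j. j < m \<Longrightarrow> bounded_functional (f j)"
    and coord: "\<And>y. y = (\<Sum>j<m. scale (f j y) (b j))"
    using finite_coordinates[OF B(1)] unfolding B(2) by blast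
  have "\<exists>R. 0 < R \<and> (\<lambda>x. f j (T x) / of_real R) \<in> form_ball scale" if "j < m" for j
    using form_of_operator[OF T f[OF that]] by metis
  then obtain R where R: "\<And>j. j < m \<Longrightarrow> 0 < R j"
    and ball: "\<And>j. j < m \<Longrightarrow> (\<lambda>x. f j (T x) / of_real (R j)) \<in> form_ball scale"
    by metis
  \<comment> \<open>the summands 1 here and in \<open>c\<close> keep the constant positive when there are no coordinates\<close>
  define W where "W = (\<Sum>j<m. R j * norm (b j)) + 1"
  have W: "0 < W" using R unfolding W_def by (intro add_nonneg_pos sum_nonneg) (auto simp: less_imp_le)
  define c where "c = W * (real m + 1) powr (1 / p)"
  have c: "0 < c" using W by (simp add: c_def)
  have "(\<Sum>i=1..k. norm (T (u i) - T (v i)) powr p) powr (1 / p)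
      \<le> c * (SUP \<phi>\<in>form_ball scale. (\<Sum>i=1..k. norm (\<phi> (u i) - \<phi> (v i)) powr p) powr (1 / p))"
    (is "?lhs powr _ \<le> c * ?S") for k :: nat and u v :: "nat \<Rightarrow> 'n \<Rightarrow> 'a"
  proof -
    define t where "t j i = norm (f j (T (u i)) / of_real (R j) - f j (T (v i)) / of_real (R j))" for j i
    have upper: "(\<Sum>i=1..k. norm (\<phi> (u i) - \<phi> (v i)) powr p) powr (1 / p) \<le> ?S"
      if "\<phi> \<in> form_ball scale" for \<phi>
      using p by (intro cSUP_upper[OF that] bdd_above_form_ball) simp
    have S: "0 \<le> ?S" by (rule order_trans[OF _ upper[OF zero_in_form_ball]]) simp
    have t: "(\<Sum>i=1..k. t j i powr p) \<le> ?S powr p" if "j < m" for j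
    proof -
      have "((\<Sum>i=1..k. t j i powr p) powr (1 / p)) powr p \<le> ?S powr p"
        using upper[OF ball[OF that]] p unfolding t_def by (intro powr_mono2) auto
      then show ?thesis using p by (simp add: powr_powr sum_nonneg)
    qed
    have "norm (T (u i) - T (v i)) powr p \<le> W powr p * (\<Sum>j<m. t j i powr p)" for i
    proof -
      define s where "s = (\<Sum>j<m. t j i powr p) powr (1 / p)"
      have ts: "t j i \<le> s" if "j < m" for j
      proof -
        have "t j i = (t j i powr p) powr (1 / p)"
          using p by (simp add: powr_powr t_def)
        also have "\<dots> \<le> s"
          unfolding s_def using that p by (intro powr_mono2 member_le_sum) auto
        finally show ?thesis .
      qed
      have "T (u i) - T (v i) = (\<Sum>j<m. scale (f j (T (u i)) - f j (T (v i))) (b j))"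
        using coord[of "T (u i)"] coord[of "T (v i)"]
        by (simp add: scale_left_diff_distrib sum_subtractf)
      also have "norm \<dots> \<le> (\<Sum>j<m. norm (scale (f j (T (u i)) - f j (T (v i))) (b j)))"
        by (rule norm_sum)
      also have "\<dots> = (\<Sum>j<m. R j * norm (b j) * t j i)"
      proof (intro sum.cong refl)
        fix j assume "j \<in> {..<m}"
        then have Rj: "0 < R j" using R by simp
        then have "norm (f j (T (u i)) - f j (T (v i))) = R j * t j i"
          by (simp add: t_def norm_divide flip: diff_divide_distrib)
        then show "norm (scale (f j (T (u i)) - f j (T (v i))) (b j)) = R j * norm (b j) * t j i"
          by (simp add: norm_scale)
      qed
      also have "\<dots> \<le> (\<Sum>j<m. R j * norm (b j) * s)"
        using R ts by (intro sum_mono mult_left_mono) (auto simp: less_imp_le)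
      also have "\<dots> \<le> W * s"
        by (simp add: W_def s_def distrib_right flip: sum_distrib_right)
      finally have "norm (T (u i) - T (v i)) powr p \<le> (W * s) powr p"
        using p by (intro powr_mono2) auto
      then show ?thesis
        using W p by (simp add: s_def powr_mult powr_powr sum_nonneg)
    qed
    then have "?lhs \<le> (\<Sum>i=1..k. W powr p * (\<Sum>j<m. t j i powr p))"
      by (rule sum_mono)
    also have "\<dots> = W powr p * (\<Sum>j<m. \<Sum>i=1..k. t j i powr p)"
      by (subst sum.swap) (simp add: sum_distrib_left)
    also have "\<dots> \<le> W powr p * (\<Sum>j<m. ?S powr p)"
      using t by (intro mult_left_mono sum_mono) auto
    also have "\<dots> \<le> W powr p * ((real m + 1) * ?S powr p)"
      by (intro mult_left_mono) (auto simp: algebra_simps)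
    also have "\<dots> = (c * ?S) powr p"
      using W S p by (simp add: c_def powr_mult powr_powr)
    finally have "?lhs powr (1 / p) \<le> ((c * ?S) powr p) powr (1 / p)"
      using p by (intro powr_mono2) (auto intro: sum_nonneg)
    then show ?thesis using p c S by (simp add: powr_powr)
  qed
  then show ?thesis
    using T c unfolding Lipschitz_summing_def by blast
qed

text \<open>
  The identity of \<open>X\<close> is a restriction of the \<open>n\<close>-linear operator \<open>T\<close> below, whose slot \<open>i0\<close> is the
  distinguished one: with \<open>e\<close> in every other slot, \<open>T\<close> returns the entry of slot \<open>i0\<close>, and forms in the unit ball
  become functionals of norm at most one.
\<close>
lemma summing_imp_identity_summing:
  fixes e :: 'a
  assumes p: "1 \<le> p" and e: "norm e = 1"
    and all: "\<And>T :: ('n::finite \<Rightarrow> 'a) \<Rightarrow> 'a.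
      T \<in> bounded_multilinear scale scale \<Longrightarrow> T \<in> Lipschitz_summing p scale scale"
  obtains D where "0 < D"
    "\<And>(xs :: 'a list) M. (\<And>f. contraction f \<Longrightarrow> (\<Sum>x\<leftarrow>xs. norm (f x) powr p) \<le> M) \<Longrightarrow>
       (\<Sum>x\<leftarrow>xs. norm x powr p) \<le> D * M"
proof -
  \<comment> \<open>the choice of the slot does not matter\<close>
  define i0 :: 'n where "i0 = undefined"
  obtain f where f: "bounded_functional f" "f e = 1"
    using functional_exists[of e] e by fastforce
  define T where "T x = scale (\<Prod>i\<in>-{i0}. f (x i)) (x i0)" for x :: "'n \<Rightarrow> 'a"
  have "T \<in> bounded_multilinear scale scale"
    unfolding bounded_multilinear_def
  proof (intro CollectI conjI allI)
    fix x :: "'n \<Rightarrow> 'a" and i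
    show "Vector_Spaces.linear scale scale (\<lambda>y. T (x(i := y)))"
    proof (cases "i = i0")
      case True
      have "T (x(i := y)) = scale (\<Prod>j\<in>-{i0}. f (x j)) y" for y
        using True by (auto simp: T_def intro!: arg_cong2[where f = scale] prod.cong)
      then show ?thesis
        by (simp add: linear_operator_iff scale_right_distrib mult.commute)
    next
      case False
      have "T (x(i := y)) = scale (f y * (\<Prod>j\<in>-{i0}-{i}. f (x j))) (x i0)" for y
      proof -
        have "(\<Prod>j\<in>-{i0}. f ((x(i := y)) j)) = f y * (\<Prod>j\<in>-{i0}-{i}. f ((x(i := y)) j))"
          using False by (subst prod.remove[of _ i]) auto
        also have "(\<Prod>j\<in>-{i0}-{i}. f ((x(i := y)) j)) = (\<Prod>j\<in>-{i0}-{i}. f (x j))"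
          by (intro prod.cong) auto
        finally show ?thesis using False by (simp add: T_def)
      qed
      then show ?thesis
        by (simp add: linear_operator_iff bounded_functionalD[OF f(1)] scale_left_distrib distrib_right mult.assoc)
    qed
  next
    obtain K where K: "0 < K" "\<And>x. norm (f x) \<le> K * norm x"
      using bounded_functional_bound[OF f(1)] by metis
    show "\<exists>K. \<forall>x. norm (T x) \<le> (\<Prod>i\<in>UNIV. norm (x i)) * K"
    proof (intro exI allI)
      fix x :: "'n \<Rightarrow> 'a"
      have "norm (T x) = (\<Prod>i\<in>-{i0}. norm (f (x i))) * norm (x i0)"
        by (simp add: T_def norm_scale prod_norm)
      also have "\<dots> \<le> (\<Prod>i\<in>-{i0}. K * norm (x i)) * norm (x i0)"
        using K by (intro mult_right_mono prod_mono) auto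
      also have "\<dots> = (\<Prod>i\<in>-{i0}. K) * ((\<Prod>i\<in>-{i0}. norm (x i)) * norm (x i0))"
        by (simp add: prod.distrib)
      also have "(\<Prod>i\<in>-{i0}. norm (x i)) * norm (x i0) = (\<Prod>i\<in>UNIV. norm (x i))"
        by (subst (2) prod.remove[of _ i0]) (auto simp: Compl_eq_Diff_UNIV mult.commute)
      finally show "norm (T x) \<le> (\<Prod>i\<in>UNIV. norm (x i)) * (\<Prod>i\<in>-{i0}. K)"
        by (simp add: mult.commute)
    qed
  qed
  then have "T \<in> Lipschitz_summing p scale scale" by (rule all)
  then obtain c where c: "0 < c" and T: "\<And>(k::nat) u v.
      (\<Sum>i=1..k. norm (T (u i) - T (v i)) powr p) powr (1 / p)
        \<le> c * (SUP \<phi>\<in>form_ball scale. (\<Sum>i=1..k. norm (\<phi> (u i) - \<phi> (v i)) powr p) powr (1 / p))"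
    unfolding Lipschitz_summing_def by blast
  show ?thesis
  proof (rule that[of "c powr p"])
    show "0 < c powr p" using c by simp
    fix xs :: "'a list" and M :: real
    assume M: "\<And>f. contraction f \<Longrightarrow> (\<Sum>x\<leftarrow>xs. norm (f x) powr p) \<le> M"
    define k where "k = length xs"
    define u where "u i = (\<lambda>_. e)(i0 := xs ! (i - 1))" for i
    define v where "v = (\<lambda>_. e)(i0 := 0)"
    have M0: "0 \<le> M"
      using M[of "\<lambda>_. 0"] p by (simp add: contraction_def linear_form_iff)
    have "T (u i) - T v = xs ! (i - 1)" for i
    proof -
      have "T ((\<lambda>_. e)(i0 := x)) = x" for x
        by (simp add: T_def f(2))
      then show ?thesis by (simp add: u_def v_def)
    qed
    then have "(\<Sum>x\<leftarrow>xs. norm x powr p) powr (1 / p)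
        \<le> c * (SUP \<phi>\<in>form_ball scale. (\<Sum>i=1..k. norm (\<phi> (u i) - \<phi> v) powr p) powr (1 / p))"
      using T[of u "\<lambda>_. v" k] by (simp add: sum_list_eq_sum_atLeast1 k_def)
    also have "\<dots> \<le> c * M powr (1 / p)"
    proof (intro mult_left_mono cSUP_least)
      show "form_ball scale \<noteq> ({} :: (('n \<Rightarrow> 'a) \<Rightarrow> 'k) set)" using zero_in_form_ball by blast
    next
      fix \<phi> :: "('n \<Rightarrow> 'a) \<Rightarrow> 'k" assume \<phi>: "\<phi> \<in> form_ball scale"
      define g where "g x = \<phi> ((\<lambda>_. e)(i0 := x))" for x
      have lin: "Vector_Spaces.linear scale (*) g"
        using \<phi> unfolding g_def form_ball_def bounded_multilinear_def by blast
      have "norm (g x) \<le> norm x" for x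
      proof -
        have "norm (g x) \<le> (\<Prod>i\<in>UNIV. norm (((\<lambda>_. e)(i0 := x)) i))"
          unfolding g_def by (rule form_ball_le[OF \<phi>])
        also have "\<dots> = (\<Prod>i\<in>UNIV. if i = i0 then norm x else 1)"
          using e by (intro prod.cong) auto
        finally show ?thesis by simp
      qed
      then have g: "contraction g" using lin by (simp add: contraction_def)
      have "g 0 = 0" using lin unfolding linear_form_iff by (metis add_cancel_right_right)
      then have "\<phi> (u i) - \<phi> v = g (xs ! (i - 1))" for i
        by (simp add: u_def v_def g_def)
      then have "(\<Sum>i=1..k. norm (\<phi> (u i) - \<phi> v) powr p) = (\<Sum>x\<leftarrow>xs. norm (g x) powr p)"
        by (simp add: sum_list_eq_sum_atLeast1 k_def)
      also have "\<dots> \<le> M" by (rule M[OF g])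
      finally show "(\<Sum>i=1..k. norm (\<phi> (u i) - \<phi> v) powr p) powr (1 / p) \<le> M powr (1 / p)"
        using p by (intro powr_mono2) (auto intro: sum_nonneg)
    qed (use c in simp)
    finally have "((\<Sum>x\<leftarrow>xs. norm x powr p) powr (1 / p)) powr p \<le> (c * M powr (1 / p)) powr p"
      using p by (intro powr_mono2) auto
    moreover have "0 \<le> (\<Sum>x\<leftarrow>xs. norm x powr p)" by (intro sum_list_nonneg) auto
    ultimately show "(\<Sum>x\<leftarrow>xs. norm x powr p) \<le> c powr p * M"
      using p c M0 by (simp add: powr_powr powr_mult)
  qed
qed

text \<open>
  Apply the hypothesis to \<open>r y = \<parallel>y\<parallel>\<^bsup>2/p-1\<^esup> y\<close>, and let \<open>S = \<Sum>\<parallel>y\<parallel>\<^sup>2\<close>. Then \<open>\<parallel>r y\<parallel>\<^sup>p = \<parallel>y\<parallel>\<^sup>2\<close>, while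
  \<open>\<bar>f(r y)\<bar>\<^sup>p \<le> \<parallel>y\<parallel> \<bar>f y\<bar> \<le> (\<parallel>y\<parallel>\<^sup>2 / D + D \<bar>f y\<bar>\<^sup>2) / 2\<close>. The weight \<open>1 / D\<close> is chosen so that the first
  term contributes \<open>S / 2\<close> after multiplication by \<open>D\<close>, which the left-hand side \<open>S\<close> absorbs. The bound
  \<open>2 M\<close> for the sum of \<open>\<bar>f y\<bar>\<^sup>2\<close> has one \<open>M\<close> for the real and one for the imaginary part of \<open>f\<close>.
\<close>
lemma identity_summing_imp_two_summing:
  assumes p: "1 \<le> p" and D: "0 < D"
    and summing: "\<And>(xs :: 'a list) M.
      (\<And>f. contraction f \<Longrightarrow> (\<Sum>x\<leftarrow>xs. norm (f x) powr p) \<le> M) \<Longrightarrow>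
      (\<Sum>x\<leftarrow>xs. norm x powr p) \<le> D * M"
  shows "two_summing_identity (2 * D\<^sup>2) TYPE('a)"
  unfolding two_summing_identity_def
proof (intro allI impI)
  fix ys :: "'a list" and M :: real
  assume M: "\<forall>f. linear f \<longrightarrow> (\<forall>x. \<bar>f x\<bar> \<le> norm x) \<longrightarrow> (\<Sum>y\<leftarrow>ys. (f y)\<^sup>2) \<le> M"
  define r where "r y = (norm y powr (2 / p - 1)) *\<^sub>R y" for y :: 'a
  define S where "S = (\<Sum>y\<leftarrow>ys. (norm y)\<^sup>2)"
  have norm_r: "norm (r y) powr p = (norm y)\<^sup>2" for y
  proof (cases "y = 0")
    case False
    then have "norm (r y) = norm y powr (2 / p)"
      by (simp add: r_def powr_diff)
    then show ?thesis using p False by (simp add: powr_powr)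
  qed (use p in \<open>simp add: r_def\<close>)
  have "(\<Sum>x\<leftarrow>map r ys. norm x powr p) \<le> D * ((S / D + D * (2 * M)) / 2)"
  proof (rule summing)
    fix f assume f: "contraction f"
    have f_r: "norm (f (r y)) = norm y powr (2 / p - 1) * norm (f y)" for y
    proof -
      have "f (r y) = of_real (norm y powr (2 / p - 1)) * f y"
        using f by (simp add: r_def contraction_def linear_form_iff flip: scale_of_real)
      then show ?thesis by (simp add: norm_mult)
    qed
    obtain g h where g: "linear g" "\<And>x. \<bar>g x\<bar> \<le> norm x" and h: "linear h" "\<And>x. \<bar>h x\<bar> \<le> norm x"
      and gh: "\<And>x. (norm (f x))\<^sup>2 = (g x)\<^sup>2 + (h x)\<^sup>2"
      using contraction_parts[OF f] by blast
    have "(\<Sum>x\<leftarrow>map r ys. norm (f x) powr p)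
        \<le> (\<Sum>y\<leftarrow>ys. ((norm y)\<^sup>2 / D + D * ((g y)\<^sup>2 + (h y)\<^sup>2)) / 2)"
      unfolding map_map o_def
    proof (rule sum_list_mono)
      fix y
      have "norm (f (r y)) powr p \<le> norm y * norm (f y)"
        unfolding f_r using f by (intro rescaled_powr_le[OF p]) (auto simp: contraction_def)
      also have "\<dots> \<le> ((norm y)\<^sup>2 / D + D * (norm (f y))\<^sup>2) / 2"
        using D sum_squares_ge_zero[of 0 "norm y - D * norm (f y)"]
        by (simp add: field_simps power2_eq_square)
      finally show "norm (f (r y)) powr p \<le> ((norm y)\<^sup>2 / D + D * ((g y)\<^sup>2 + (h y)\<^sup>2)) / 2"
        by (simp add: gh)
    qed
    also have "\<dots> = (S / D + D * ((\<Sum>y\<leftarrow>ys. (g y)\<^sup>2) + (\<Sum>y\<leftarrow>ys. (h y)\<^sup>2))) / 2"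
      unfolding S_def by (induction ys) (auto simp: add_divide_distrib algebra_simps)
    also have "\<dots> \<le> (S / D + D * (2 * M)) / 2"
    proof -
      have "(\<Sum>y\<leftarrow>ys. (g y)\<^sup>2) + (\<Sum>y\<leftarrow>ys. (h y)\<^sup>2) \<le> 2 * M"
        using M[rule_format, OF g(1)] M[rule_format, OF h(1)] g(2) h(2) by fastforce
      then show ?thesis using D by (simp add: mult_left_mono divide_right_mono)
    qed
    finally show "(\<Sum>x\<leftarrow>map r ys. norm (f x) powr p) \<le> (S / D + D * (2 * M)) / 2" .
  qed
  then have "S \<le> D * ((S / D + D * (2 * M)) / 2)"
    by (simp add: S_def norm_r o_def)
  also have "\<dots> = S / 2 + D\<^sup>2 * M" using D by (simp add: field_simps power2_eq_square)
  finally show "(\<Sum>y\<leftarrow>ys. (norm y)\<^sup>2) \<le> 2 * D\<^sup>2 * M" by (simp add: S_def)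
qed

lemma real_span_subset_span: "Real_Vector_Spaces.span B \<subseteq> span B"
proof (rule real_vector.span_minimal)
  show "B \<subseteq> span B" by (rule span_superset)
  show "Real_Vector_Spaces.subspace (span B)"
    by (auto simp: real_vector.subspace_def span_zero span_add span_scale simp flip: scale_of_real)
qed

theorem all_multilinear_summing_iff_finite_dimensional:
  assumes p: "1 \<le> p"
  shows "(Lipschitz_summing p scale scale :: (('n::finite \<Rightarrow> 'a) \<Rightarrow> 'a) set)
           = bounded_multilinear scale scale
         \<longleftrightarrow> (\<exists>B. finite_dimensional_vector_space scale B)" (is "?summing \<longleftrightarrow> ?fd")
proof
  assume ?fd
  then obtain B where "finite_dimensional_vector_space scale B" by blast
  then have "finite B" "span B = UNIV"
    by (simp_all add: finite_dimensional_vector_space.finite_Basis finite_dimensional_vector_space.span_Basis)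
  then show ?summing
    using finite_span_imp_summing[OF p] by (auto simp: Lipschitz_summing_def)
next
  assume ?summing
  then have all: "\<And>T :: ('n \<Rightarrow> 'a) \<Rightarrow> 'a.
      T \<in> bounded_multilinear scale scale \<Longrightarrow> T \<in> Lipschitz_summing p scale scale"
    by blast
  \<comment> \<open>the zero space is treated apart because it has no unit vector\<close>
  have "\<exists>B. finite B \<and> span B = UNIV"
  proof (cases "\<exists>x :: 'a. x \<noteq> 0")
    case True
    then obtain x :: 'a where "x \<noteq> 0" by blast
    then have "norm (x /\<^sub>R norm x) = 1" by simp
    from summing_imp_identity_summing[OF p this all] obtain D where D: "0 < D"
      "\<And>(xs :: 'a list) M. (\<And>f. contraction f \<Longrightarrow> (\<Sum>x\<leftarrow>xs. norm (f x) powr p) \<le> M) \<Longrightarrow>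
         (\<Sum>x\<leftarrow>xs. norm x powr p) \<le> D * M"
      by metis
    have "two_summing_identity (2 * D\<^sup>2) TYPE('a)"
      by (rule identity_summing_imp_two_summing[OF p D])
    then obtain B :: "'a set" where "finite B" "Real_Vector_Spaces.span B = UNIV"
      by (rule two_summing_identity_imp_finite_span[rotated]) auto
    then show ?thesis using real_span_subset_span[of B] by auto
  next
    case False
    then have "span {} = (UNIV :: 'a set)" by auto
    then show ?thesis by blast
  qed
  then obtain B where B: "finite B" "span B = UNIV" by blast
  obtain B' where B': "B' \<subseteq> B" "independent B'" "B \<subseteq> span B'"
    using maximal_independent_subset[of B] by metis
  have "span B' = UNIV"
    using span_mono[OF B'(3)] B(2) by (auto simp: span_span)
  then have "finite_dimensional_vector_space scale B'"
    using B' B(1) by unfold_locales (auto intro: finite_subset)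
  then show ?fd by blast
qed

end

section \<open>The real and the complex field\<close>

lemma banach_space_over_RC_real:
  "banach_space_over_RC ((*\<^sub>R) :: real \<Rightarrow> 'a::banach \<Rightarrow> 'a)"
proof -
  interpret banach_space_over "(*\<^sub>R) :: real \<Rightarrow> 'a \<Rightarrow> 'a"
    by (rule banach_space_over_scaleR)
  show ?thesis
  proof unfold_locales
    fix w :: 'a assume w: "w \<noteq> 0"
    obtain l where l: "linear l" "\<And>x. \<bar>l x\<bar> \<le> norm x" "l w = norm w"
      using norming_functional[of w] by metis
    have "norm (l x / norm w) \<le> inverse (norm w) * norm x" for x
      using l(2)[of x] by (simp add: divide_simps)
    then have "bounded_functional (\<lambda>x. l x / norm w)"
      unfolding bounded_functional_def linear_form_iff
      by (auto simp: linear_add[OF l(1)] linear_scale[OF l(1)] add_divide_distrib)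
    moreover have "l w / norm w = 1" using w l(3) by simp
    ultimately show "\<exists>f. bounded_functional f \<and> f w = 1" by blast
  next
    fix f :: "'a \<Rightarrow> real" assume "contraction f"
    then have "linear f" "\<And>x. \<bar>f x\<bar> \<le> norm x"
      by (simp_all add: contraction_def linear_form_iff linear_iff)
    moreover have "linear (\<lambda>_ :: 'a. 0 :: real)" by (simp add: linear_iff)
    ultimately show "\<exists>g h. linear g \<and> linear h \<and>
        (\<forall>x. (norm (f x))\<^sup>2 = (g x)\<^sup>2 + (h x)\<^sup>2 \<and> \<bar>g x\<bar> \<le> norm x \<and> \<bar>h x\<bar> \<le> norm x)"
      by (intro exI[of _ f] exI[of _ "\<lambda>_. 0"]) auto
  qed
qed

text \<open>
  A real functional \<open>l\<close> is the real part of exactly one complex functional, \<open>x \<mapsto> l(x) - \<i> l(\<i> x)\<close>. Its norm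
  is only estimated by 2, which suffices for boundedness.
\<close>
lemma banach_space_over_RC_complex:
  fixes scaleC :: "complex \<Rightarrow> 'a::banach \<Rightarrow> 'a"
  assumes "banach_space_over scaleC"
  shows "banach_space_over_RC scaleC"
proof -
  interpret banach_space_over scaleC by fact
  have scaleR: "scaleC (of_real r) x = r *\<^sub>R x" for r x by (rule scale_of_real)
  show ?thesis
  proof unfold_locales
    fix w :: 'a assume w: "w \<noteq> 0"
    obtain l where l: "linear l" "\<And>x. \<bar>l x\<bar> \<le> norm x" "l w = norm w"
      using norming_functional[of w] by metis
    define f where "f x = Complex (l x) (- l (scaleC \<i> x))" for x
    have fw: "f w \<noteq> 0" using l(3) w by (simp add: f_def complex_eq_iff)
    have add: "f (x + y) = f x + f y" for x y
      by (simp add: f_def linear_add[OF l(1)] scale_right_distrib complex_eq_iff)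
    have scale: "f (scaleC c x) = c * f x" for c x
    proof -
      have split: "scaleC (Complex a b) y = a *\<^sub>R y + b *\<^sub>R scaleC \<i> y" for a b y
      proof -
        have "scaleC (Complex a b) y = scaleC (of_real a + of_real b * \<i>) y"
          by (simp add: Complex_eq mult.commute)
        also have "\<dots> = scaleC (of_real a) y + scaleC (of_real b) (scaleC \<i> y)"
          by (simp only: scale_left_distrib scale_scale)
        finally show ?thesis by (simp only: scaleR)
      qed
      have x: "scaleC c x = Re c *\<^sub>R x + Im c *\<^sub>R scaleC \<i> x"
        using split[of "Re c" "Im c" x] by simp
      have "scaleC \<i> (scaleC c x) = scaleC (Complex (- Im c) (Re c)) x"
        by (simp only: scale_scale) (simp add: complex_eq_iff arg_cong2[where f = scaleC])
      also have "\<dots> = (- Im c) *\<^sub>R x + Re c *\<^sub>R scaleC \<i> x" by (rule split)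
      finally have ix: "scaleC \<i> (Re c *\<^sub>R x + Im c *\<^sub>R scaleC \<i> x)
          = (- Im c) *\<^sub>R x + Re c *\<^sub>R scaleC \<i> x"
        by (simp only: x)
      show ?thesis unfolding f_def x ix
        by (simp add: linear_add[OF l(1)] linear_diff[OF l(1)] linear_neg[OF l(1)] linear_scale[OF l(1)] complex_eq_iff)
    qed
    have "norm (f x / f w) \<le> 2 / norm (f w) * norm x" for x
    proof -
      have "norm (f x) \<le> \<bar>l x\<bar> + \<bar>l (scaleC \<i> x)\<bar>"
        using cmod_le[of "f x"] by (simp add: f_def)
      also have "\<dots> \<le> 2 * norm x"
        using l(2)[of x] l(2)[of "scaleC \<i> x"] by (simp add: norm_scale)
      finally show ?thesis by (simp add: norm_divide divide_right_mono)
    qed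
    then have "\<exists>K. \<forall>x. norm (f x / f w) \<le> K * norm x" by blast
    then have "bounded_functional (\<lambda>x. f x / f w)"
      unfolding bounded_functional_def linear_form_iff
      by (simp add: add scale add_divide_distrib)
    then show "\<exists>g. bounded_functional g \<and> g w = 1" using fw by fastforce
  next
    fix f :: "'a \<Rightarrow> complex" assume f: "contraction f"
    then have add: "f (x + y) = f x + f y" and scale: "f (r *\<^sub>R x) = of_real r * f x"
      and le: "norm (f x) \<le> norm x" for x y r
      by (simp_all add: contraction_def linear_form_iff flip: scaleR)
    have "linear (\<lambda>x. Re (f x))" "linear (\<lambda>x. Im (f x))"
      by (simp_all add: linear_iff add scale)
    moreover have "\<bar>Re (f x)\<bar> \<le> norm x" "\<bar>Im (f x)\<bar> \<le> norm x" for x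
      using abs_Re_le_cmod[of "f x"] abs_Im_le_cmod[of "f x"] le[of x] by simp_all
    ultimately show "\<exists>g h. linear g \<and> linear h \<and>
        (\<forall>x. (norm (f x))\<^sup>2 = (g x)\<^sup>2 + (h x)\<^sup>2 \<and> \<bar>g x\<bar> \<le> norm x \<and> \<bar>h x\<bar> \<le> norm x)"
      by (intro exI[of _ "\<lambda>x. Re (f x)"] exI[of _ "\<lambda>x. Im (f x)"]) (simp add: cmod_power2)
  qed
qed

theorem corollary3p12:
  fixes p :: real
    and scaleC :: "complex \<Rightarrow> 'c::banach \<Rightarrow> 'c"
  assumes "1 \<le> p"
    and "banach_space_over scaleC"
  shows "((Lipschitz_summing p (*\<^sub>R) (*\<^sub>R) :: (('n::finite \<Rightarrow> 'r::banach) \<Rightarrow> 'r) set)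
            = bounded_multilinear (*\<^sub>R) (*\<^sub>R)
          \<longleftrightarrow> (\<exists>B. finite_dimensional_vector_space ((*\<^sub>R) :: real \<Rightarrow> 'r \<Rightarrow> 'r) B))
       \<and> ((Lipschitz_summing p scaleC scaleC :: (('n \<Rightarrow> 'c) \<Rightarrow> 'c) set)
            = bounded_multilinear scaleC scaleC
          \<longleftrightarrow> (\<exists>B. finite_dimensional_vector_space scaleC B))"
  using banach_space_over_RC.all_multilinear_summing_iff_finite_dimensional[OF banach_space_over_RC_real assms(1)]
    banach_space_over_RC.all_multilinear_summing_iff_finite_dimensional[OF
      banach_space_over_RC_complex[OF assms(2)] assms(1)]
  by blast

end
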